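(* Let $\alpha\in(0,1)$ be fixed, let $\bar\pi$ run through a sequence of probability distributions on $\mathcal{H}$ with finite entropies such that $\bar\pi\to0$ (i.e. $\sup_{h\in\mathcal{H}}\bar\pi_h\to0$), and suppose that $$\lim_{\bar{\pi}\to0}\frac{1}{\log H_{\bar{\pi}}}\sum_{h\in\mathcal{H}}\bar{\pi}_h\Bigl|H_{\bar{\pi}}-\log\frac{1}{\bar{\pi}_h}\Bigr|=0 .$$ Let $\mathbf{A}=\{A_h,\,h\in\mathcal{H}\}$ be amplitudes $A_h>0$ (which may depend on $\bar\pi$). (i) If for some $x\in\mathbb{R}$ and $\epsilon>0$ $$\lim_{\bar{\pi}\to0}\frac{1}{H^*_{\bar{\pi}}}\mathbf{E}_{\bar{\pi}}\Bigl[\Bigl(\frac{A_h}{\sigma_h}-x\Bigr)^2+\epsilon H^*_{\bar{\pi}}-R_h(q_\alpha^\varkappa,H_{\bar{\pi}})\Bigr]_+=0,$$ then $$\liminf_{\bar{\pi}\to0}\bar{\beta}^M_{\bar{\pi}}(\mathbf{A})\ge(1-\alpha)[1-\Phi(x)].$$ (ii) If for some $\epsilon>0$ $$\lim_{\bar{\pi}\to0}\frac{1}{H^*_{\bar{\pi}}}\mathbf{E}_{\bar{\pi}}\Bigl[R_h(q_\alpha^\varkappa,H_{\bar{\pi}})+2\sqrt{\epsilon H^*_{\bar{\pi}}}\,\frac{A_h}{\sigma_h}-\frac{A_h^2}{\sigma_h^2}\Bigr]_+=0,$$ then $$\lim_{\bar{\pi}\to0}\bar{\beta}^M_{\bar{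\pi}}(\mathbf{A})=0.$$
   Context: Model. $\mathcal{H}=\{1/2,1/4,\ldots,2^{-k},\ldots\}$; for $h\in\mathcal{H}$, $\mathcal{G}_h=\{h,3h,\ldots,1-h\}$ and $n_h=1/(2h)=|\mathcal{G}_h|$. One observes $\hat\theta_{h,t}=\theta_{h,t}+\sigma_h\xi_{h,t}$, $h\in\mathcal{H}$, $t\in\mathcal{G}_h$, where $\sigma_h=\sigma\sqrt{2/h}$ with known fixed $\sigma>0$, the $\xi_{h,t}$ are i.i.d. $\mathcal{N}(0,1)$ and $\Theta=\{\theta_{h,t}\}$ is an unknown array of reals; $\mathbf{P}_\Theta$ is the law of the observations. $\Phi$ is the standard Gaussian distribution function and $S(x)=\frac1{\Phi(x)}-1$. MAP multi-level test. Let $q_\alpha^\varkappa=-\log\bigl(\log\frac{1}{1-\alpha}\bigr)$ and $$Z_h^M=\max_{t\in\mathcal{G}_h}\log\Bigl[\frac1{n_h}S\Bigl(\frac{\hat\theta_{h,t}}{\sigma_h}\Bigr)\Bigr].$$ For a probability distribution $\bar\pi=(\bar\pi_h)$ on $\mathcal{H}$, the test rejects the null hypothesis (all $\theta_{h,t}\ge0$) if $\sup_{h\in\mathcal{H}}\{Z_h^M+\log\bar\pi_h\}\ge q_\alpha^\varkappa$ (with $\log0=-\infty$). Type II errors. For $\rho\in\mathcal{H}$, $\tau\in\mathcal{G}_\rho$, $A>0$ let $\Theta_{\rho,\tau}(A)$ be the set of arrays $\{\theta_{h,t}\}$ with $\theta_{\rho,\tau}=-A$ and $\theta_{h,t}\ge0$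 for all $(h,t)\ne(\rho,\tau)$. Put $$\beta^M_{\rho,\tau}(A)=\sup_{\Theta\in\Theta_{\rho,\tau}(A)}\mathbf{P}_\Theta\Bigl\{\sup_{h\in\mathcal{H}}[Z_h^M+\log\bar\pi_h]\le q_\alpha^\varkappa\Bigr\},\qquad \bar\beta^M_{\bar\pi}(\mathbf{A})=\sum_{h\in\mathcal{H}}\frac{\bar\pi_h}{n_h}\sum_{t\in\mathcal{G}_h}\beta^M_{h,t}(A_h).$$ Notation. $H_{\bar\pi}=\sum_{h\in\mathcal{H}}\bar\pi_h\log\frac1{\bar\pi_h}$ (entropy, with $0\log(1/0)=0$); $H^*_{\bar\pi}=\log(H_{\bar\pi})$; $\mathbf{E}_{\bar\pi}[f_h]=\sum_{h\in\mathcal{H}}\bar\pi_hf_h$; $[y]_+=\max(y,0)$; and $$R_h(q,H)=2[q+\log(n_h)+H]-\log[4\pi(q+\log(n_h)+H)],$$ where $\pi$ without a bar is the usual constant. Since $H_{\bar\pi}\to\infty$ as $\bar\pi\to0$, $H^*_{\bar\pi}$ is positive and $R_h(q_\alpha^\varkappa,H_{\bar\pi})$ is well defined once $\sup_h\bar\pi_h$ is small enough. *)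

theory Defs
  imports "HOL-Probability.Probability"
begin

definition scales :: "real set" where
  "scales = {(1 / 2) ^ k | k :: nat. k \<ge> 1}"

definition grid :: "real \<Rightarrow> real set" where
  "grid h = {(2 * real j + 1) * h | j :: nat. (2 * real j + 1) * h \<le> 1 - h}"

definition n_scale :: "real \<Rightarrow> real" where
  "n_scale h = 1 / (2 * h)"

lemma grid_eq_image:
  assumes "k \<ge> 1"
  shows "grid ((1 / 2) ^ k) = (\<lambda>j. (2 * real j + 1) * (1 / 2) ^ k) ` {..<2 ^ (k - 1)}"
proof -
  obtain l where k: "k = Suc l"
    using assms by (cases k) auto
  have "(2 * real j + 1) * (1 / 2) ^ k \<le> 1 - (1 / 2) ^ k \<longleftrightarrow> j < 2 ^ l" for j :: nat
  proof -
    have "(2 * real j + 1) * (1 / 2) ^ k \<le> 1 - (1 / 2) ^ k \<longleftrightarrow> real j + 1 \<le> 2 ^ l"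
    proof -
      define a :: real where "a = 2 ^ l"
      have "a > 0" "(1 / 2) ^ k = 1 / (2 * a)"
        by (simp_all add: a_def k power_one_over)
      then show ?thesis
        unfolding a_def[symmetric]
        using mult_le_cancel_left_pos[of "4 * a" "real j + 1" a] by (simp add: field_simps)
    qed
    also have "\<dots> \<longleftrightarrow> real (j + 1) \<le> real (2 ^ l)"
      by (simp add: add.commute)
    also have "\<dots> \<longleftrightarrow> j < 2 ^ l"
      unfolding of_nat_le_iff by auto
    finally show ?thesis .
  qed
  then show ?thesis
    unfolding grid_def k by auto
qed

lemma finite_grid: "h \<in> scales \<Longrightarrow> finite (grid h)"
  by (auto simp: scales_def grid_eq_image)

lemma n_scale_eq_card:
  assumes "h \<in> scales"
  shows "n_scale h = real (card (grid h))"
proof -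
  obtain k where k: "k \<ge> 1" "h = (1 / 2) ^ k"
    using assms by (auto simp: scales_def)
  have "inj_on (\<lambda>j. (2 * real j + 1) * (1 / 2) ^ k) {..<2 ^ (k - 1)}"
    by (auto simp: inj_on_def)
  then have "card (grid h) = 2 ^ (k - 1)"
    unfolding k(2) grid_eq_image[OF k(1)] by (simp add: card_image)
  moreover have "n_scale h = 2 ^ (k - 1)"
    using k by (cases k) (auto simp: n_scale_def power_one_over)
  ultimately show ?thesis by simp
qed

lemma countable_scales: "countable scales"
proof -
  have "scales = (\<lambda>k. (1 / 2) ^ k) ` {1..}"
    by (auto simp: scales_def)
  then show ?thesis by (metis countableI_type countable_image)
qed

definition sigma_scale :: "real \<Rightarrow> real \<Rightarrow> real" where
  "sigma_scale \<sigma> h = \<sigma> * sqrt (2 / h)"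

definition indices :: "(real \<times> real) set" where
  "indices = (SIGMA h:scales. grid h)"

definition noise :: "(real \<times> real \<Rightarrow> real) measure" where
  "noise = PiM indices (\<lambda>_. std_normal_distribution)"

text \<open>The law of the observed array. A parameter array is a function on all pairs, of which only
  the values on the index set matter.\<close>

definition obs_law :: "real \<Rightarrow> (real \<times> real \<Rightarrow> real) \<Rightarrow> (real \<times> real \<Rightarrow> real) measure" where
  "obs_law \<sigma> \<Theta> = distr noise (PiM indices (\<lambda>_. borel))
     (\<lambda>\<xi>. \<lambda>(h, t)\<in>indices. \<Theta> (h, t) + sigma_scale \<sigma> h * \<xi> (h, t))"

lemma noise_shift_measurable:
  "(\<lambda>\<xi>. \<lambda>(h, t)\<in>indices. \<Theta> (h, t) + sigma_scale \<sigma> h * \<xi> (h, t))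
     \<in> noise \<rightarrow>\<^sub>M PiM indices (\<lambda>_. borel)"
proof (rule measurable_restrict)
  fix i assume i: "i \<in> indices"
  obtain h t where ht: "i = (h, t)" by (cases i)
  have "(\<lambda>\<xi>. \<xi> (h, t)) \<in> noise \<rightarrow>\<^sub>M std_normal_distribution"
    using i unfolding ht noise_def by (rule measurable_component_singleton)
  then have [measurable]: "(\<lambda>\<xi>. \<xi> (h, t)) \<in> borel_measurable noise"
    by (simp add: measurable_def)
  show "(\<lambda>\<xi>. case i of (h, t) \<Rightarrow> \<Theta> (h, t) + sigma_scale \<sigma> h * \<xi> (h, t)) \<in> borel_measurable noise"
    unfolding ht by simp
qed

lemma prob_space_obs_law: "prob_space (obs_law \<sigma> \<Theta>)"
proof -
  interpret S: real_distribution std_normal_distribution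
    by (rule real_dist_normal_dist)
  have "prob_space noise"
    unfolding noise_def by (rule prob_space_PiM) (rule S.prob_space_axioms)
  then show ?thesis
    unfolding obs_law_def by (rule prob_space.prob_space_distr[OF _ noise_shift_measurable])
qed

definition Phi :: "real \<Rightarrow> real" where
  "Phi = cdf std_normal_distribution"

definition S :: "real \<Rightarrow> real" where
  "S x = 1 / Phi x - 1"

definition q_level :: "real \<Rightarrow> real" where
  "q_level \<alpha> = - ln (ln (1 / (1 - \<alpha>)))"

definition Z_M :: "real \<Rightarrow> real \<Rightarrow> (real \<times> real \<Rightarrow> real) \<Rightarrow> real" where
  "Z_M \<sigma> h y = (MAX t\<in>grid h. ln (1 / n_scale h * S (y (h, t) / sigma_scale \<sigma> h)))"

text \<open>The logarithm on \<open>[0, \<infinity>)\<close> with \<open>log 0 = -\<infinity>\<close>.\<close>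

definition eln :: "real \<Rightarrow> ereal" where
  "eln x = (if x = 0 then -\<infinity> else ereal (ln x))"

definition map_statistic :: "real \<Rightarrow> real pmf \<Rightarrow> (real \<times> real \<Rightarrow> real) \<Rightarrow> ereal" where
  "map_statistic \<sigma> p y = (SUP h\<in>scales. ereal (Z_M \<sigma> h y) + eln (pmf p h))"

lemma map_statistic_measurable:
  "map_statistic \<sigma> p \<in> borel_measurable (obs_law \<sigma> \<Theta>)"
proof -
  interpret S: real_distribution std_normal_distribution
    by (rule real_dist_normal_dist)
  have [measurable]: "Phi \<in> borel_measurable borel"
    unfolding Phi_def by (rule borel_measurable_mono) (simp add: mono_def S.cdf_nondecreasing)
  have [measurable]: "S \<in> borel_measurable borel"
    unfolding S_def by measurable
  let ?M = "PiM indices (\<lambda>_. borel) :: (real \<times> real \<Rightarrow> real) measure"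
  have Z: "Z_M \<sigma> h \<in> borel_measurable ?M" if h: "h \<in> scales" for h
    unfolding Z_M_def
  proof (rule borel_measurable_Max[OF finite_grid[OF h]])
    fix t assume "t \<in> grid h"
    with h have "(h, t) \<in> indices" by (simp add: indices_def)
    then have [measurable]: "(\<lambda>y. y (h, t)) \<in> borel_measurable ?M"
      by (rule measurable_component_singleton)
    show "(\<lambda>y. ln (1 / n_scale h * S (y (h, t) / sigma_scale \<sigma> h))) \<in> borel_measurable ?M"
      by measurable
  qed
  have "map_statistic \<sigma> p \<in> borel_measurable ?M"
    unfolding map_statistic_def
    by (intro borel_measurable_SUP countable_scales borel_measurable_ereal_add
        borel_measurable_ereal borel_measurable_const Z)
  then show ?thesis
    by (simp add: obs_law_def)
qed

definition alternatives :: "real \<Rightarrow> real \<Rightarrow> real \<Rightarrow> (real \<times> real \<Rightarrow> real) set" where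
  "alternatives \<rho> \<tau> A =
     {\<Theta>. \<Theta> (\<rho>, \<tau>) = - A \<and> (\<forall>i \<in> indices - {(\<rho>, \<tau>)}. \<Theta> i \<ge> 0)}"

definition beta_M :: "real \<Rightarrow> real \<Rightarrow> real pmf \<Rightarrow> real \<Rightarrow> real \<Rightarrow> real \<Rightarrow> real" where
  "beta_M \<sigma> \<alpha> p \<rho> \<tau> A =
     (SUP \<Theta>\<in>alternatives \<rho> \<tau> A.
        \<P>(y in obs_law \<sigma> \<Theta>. map_statistic \<sigma> p y \<le> ereal (q_level \<alpha>)))"

definition avg_beta_M :: "real \<Rightarrow> real \<Rightarrow> real pmf \<Rightarrow> (real \<Rightarrow> real) \<Rightarrow> real" where
  "avg_beta_M \<sigma> \<alpha> p A =
     (\<Sum>\<^sub>\<infinity>h\<in>scales. pmf p h / n_scale h * (\<Sum>t\<in>grid h. beta_M \<sigma> \<alpha> p h t (A h)))"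

definition finite_entropy :: "real pmf \<Rightarrow> bool" where
  "finite_entropy p \<longleftrightarrow> (\<lambda>h. pmf p h * ln (1 / pmf p h)) summable_on scales"

definition entropy :: "real pmf \<Rightarrow> real" where
  "entropy p = (\<Sum>\<^sub>\<infinity>h\<in>scales. pmf p h * ln (1 / pmf p h))"

definition entropy_star :: "real pmf \<Rightarrow> real" where
  "entropy_star p = ln (entropy p)"

text \<open>The expectation of the positive part takes values in \<open>[0, \<infinity>]\<close>: a Bochner integral would
  give 0 when the expectation is infinite.\<close>

definition E_pos :: "real pmf \<Rightarrow> (real \<Rightarrow> real) \<Rightarrow> ennreal" where
  "E_pos p f = (\<integral>\<^sup>+ h. ennreal (max (f h) 0) \<partial>measure_pmf p)"

definition R :: "real \<Rightarrow> real \<Rightarrow> real \<Rightarrow> real" where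
  "R h q H = 2 * (q + ln (n_scale h) + H) - ln (4 * pi * (q + ln (n_scale h) + H))"

end

theory Submission
  imports Defs "HOL-Real_Asymp.Real_Asymp"
begin

text \<open>
  On the p-value scale \<open>U = \<Phi>(y / \<sigma>\<^sub>h)\<close> the test accepts iff every coordinate satisfies
  \<open>U \<ge> r\<^sub>h\<close> with \<open>r\<^sub>h = w / (w + n\<^sub>h e\<^sup>q)\<close>, where \<open>w\<close> is the prior weight of the scale
  (\<open>map_statistic_le_iff\<close>). Under zero signal \<open>U\<close> is uniform, and the level \<open>q\<close> is such that
  \<open>1 - r\<^sub>h \<ge> (1 - \<alpha>) powr (w / n\<^sub>h)\<close>. As the exponents over all coordinates sum to the total
  prior mass, independence makes the acceptance probability under the null at least \<open>1 - \<alpha>\<close>.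

  With a single spike of height \<open>-A\<close> on scale \<open>h\<close> and zeros elsewhere, write \<open>a = A / \<sigma>\<^sub>h\<close>. The
  spike coordinate is accepted whenever its noise exceeds \<open>x\<close>, provided \<open>r\<^sub>h \<le> \<Phi>(x - a)\<close>; so its
  type II error is then at least \<open>(1 - \<alpha>) (1 - \<Phi>(x))\<close> (\<open>beta_M_lower\<close>). Conversely, looking at the
  spike coordinate alone, the type II error is at most \<open>1 - \<Phi>(M)\<close> once \<open>\<Phi>(M - a) < r\<^sub>h\<close>
  (\<open>beta_M_upper\<close>).

  It remains to compare \<open>r\<^sub>h\<close> with a Gaussian tail. Up to a factor 2, and as long as
  \<open>w \<le> n\<^sub>h e\<^sup>q\<close>, the cutoff \<open>r\<^sub>h\<close> is
  \<open>exp (- (q + log n\<^sub>h + log (1 / w)))\<close>. Call a scale good if \<open>log (1 / w)\<close> deviates from the entropy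
  \<open>H\<close> by at most \<open>(\<epsilon> / 8) log H\<close> and the bracket in the hypothesis is at most
  \<open>(\<epsilon> / 2) log H\<close>. By Markov's inequality the bad scales have vanishing prior mass, both times
  because the relevant expectation is \<open>o(log H)\<close>. On a good scale \<open>r\<^sub>h\<close> is \<open>exp (-L)\<close> up to a factor
  \<open>exp (\<plusminus> (\<epsilon> / 8) log H)\<close>, with \<open>L = q + log n\<^sub>h + H\<close>, whereas \<open>R\<^sub>h = 2 L - log (4 \<pi> L)\<close> is the
  squared Gaussian quantile at tail probability of order \<open>exp (-L)\<close>, by the tail estimates
  \<open>\<Phi>(-u) \<asymp> \<phi>(u) / u\<close> for \<open>u \<ge> 1\<close>. The bracket, in the
  second claim after completing the square, moves the squared argument by \<open>(\<epsilon> / 2) log H\<close> away from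
  \<open>R\<^sub>h\<close>, hence the tail by a factor \<open>exp (\<plusminus> (\<epsilon> / 4) log H)\<close>, which dominates the other factor and all
  constants because \<open>H \<rightarrow> \<infinity>\<close> (\<open>cutoff_le_Phi_of_small_amplitude\<close>,
  \<open>Phi_less_cutoff_of_large_amplitude\<close>). Averaging over good scales gives both claims.
\<close>

section \<open>The Gaussian distribution function\<close>

interpretation std_normal: real_distribution std_normal_distribution
  by (rule real_dist_normal_dist)

lemma std_normal_reflect:
  "measure std_normal_distribution {u..} = Phi (- u)"
proof -
  have "emeasure std_normal_distribution {..- u}
      = (\<integral>\<^sup>+ t. ennreal (std_normal_density t) * indicator {..- u} t \<partial>lborel)"
    by (simp add: emeasure_density)
  also have "\<dots> = (\<integral>\<^sup>+ t. ennreal (std_normal_density (- t)) * indicator {..- u} (- t) \<partial>lborel)"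
    by (subst nn_integral_real_affine[where c = "-1" and t = 0]) auto
  also have "\<dots> = (\<integral>\<^sup>+ t. ennreal (std_normal_density t) * indicator {u..} t \<partial>lborel)"
    by (intro nn_integral_cong) (auto simp: normal_density_def split: split_indicator)
  also have "\<dots> = emeasure std_normal_distribution {u..}"
    by (simp add: emeasure_density)
  finally show ?thesis
    by (simp add: Phi_def cdf_def measure_def)
qed

lemma Phi_uminus_conv:
  "ennreal (Phi (- u)) = (\<integral>\<^sup>+ t. ennreal (std_normal_density t) * indicator {u..} t \<partial>lborel)"
proof -
  have "ennreal (Phi (- u)) = emeasure std_normal_distribution {u..}"
    by (simp add: std_normal_reflect[symmetric] std_normal.emeasure_eq_measure)
  then show ?thesis by (simp add: emeasure_density)
qed

lemma Phi_mono: "x \<le> y \<Longrightarrow> Phi x \<le> Phi y"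
  unfolding Phi_def by (rule std_normal.cdf_nondecreasing)

lemma Phi_nonneg: "0 \<le> Phi x"
  unfolding Phi_def by (rule std_normal.cdf_nonneg)

lemma Phi_le_1: "Phi x \<le> 1"
  unfolding Phi_def by (rule std_normal.cdf_bounded_prob)

text \<open>On the half-line \<open>t \<ge> b\<close> the density \<open>\<phi>(t)\<close> is at most \<open>t \<phi>(t) / b\<close>, which has the
  primitive \<open>- \<phi>(t) / b\<close>. The factor \<open>1 / b\<close> matters: it cancels the logarithmic term of \<open>R\<^sub>h\<close>.\<close>

lemma Phi_tail_upper:
  assumes "b > 0"
  shows "Phi (- b) \<le> std_normal_density b / b"
proof -
  have "ennreal (Phi (- b)) = (\<integral>\<^sup>+ t. ennreal (std_normal_density t) * indicator {b..} t \<partial>lborel)"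
    by (rule Phi_uminus_conv)
  also have "\<dots> \<le> (\<integral>\<^sup>+ t. ennreal (t / b * std_normal_density t) * indicator {b..} t \<partial>lborel)"
    using assms
    by (intro nn_integral_mono)
       (auto split: split_indicator intro!: ennreal_leI mult_right_mono simp: field_simps)
  also have "\<dots> = ennreal (0 - (- (std_normal_density b / b)))"
  proof (rule nn_integral_FTC_atLeast[where F = "\<lambda>t. - (std_normal_density t / b)" and T = 0])
    show "((\<lambda>t. - (std_normal_density t / b)) has_real_derivative t / b * std_normal_density t) (at t)"
      for t
      unfolding std_normal_density_def
      by (rule derivative_eq_intros refl | (use assms in \<open>simp add: field_simps; fail\<close>))+
    show "((\<lambda>t. - (std_normal_density t / b)) \<longlongrightarrow> 0) at_top"
      unfolding std_normal_density_def using assms by real_asymp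
  qed (use assms in auto)
  finally show ?thesis
    using assms by (simp add: ennreal_le_iff)
qed

text \<open>Only the interval from \<open>u\<close> to \<open>u + 1 / u\<close> is kept, on which the density loses at most the
  factor \<open>exp (- 3 / 2)\<close>. Constants are harmless here, so this replaces the sharper Mills bound.\<close>

lemma Phi_tail_lower:
  assumes "u \<ge> 1"
  shows "exp (- 3 / 2) * std_normal_density u / u \<le> Phi (- u)"
proof -
  let ?d = "std_normal_density (u + 1 / u)"
  have "exp (- 3 / 2) * std_normal_density u \<le> ?d"
  proof -
    have "(u + 1 / u)\<^sup>2 = u\<^sup>2 + 2 + (1 / u)\<^sup>2"
      using assms by (simp add: power2_sum)
    moreover have "(1 / u)\<^sup>2 \<le> 1"
      using assms by (simp add: power_le_one)
    ultimately have "- 3 / 2 + - u\<^sup>2 / 2 \<le> - (u + 1 / u)\<^sup>2 / 2"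
      by simp
    then show ?thesis
      unfolding std_normal_density_def
      by (simp add: exp_add[symmetric] divide_right_mono)
  qed
  moreover have "ennreal (?d * (1 / u)) \<le> ennreal (Phi (- u))"
  proof -
    have "ennreal (?d * (1 / u)) = (\<integral>\<^sup>+ t. ennreal ?d * indicator {u..u + 1 / u} t \<partial>lborel)"
      using assms by (simp add: nn_integral_cmult_indicator flip: ennreal_mult)
    also have "\<dots> \<le> (\<integral>\<^sup>+ t. ennreal (std_normal_density t) * indicator {u..} t \<partial>lborel)"
      using assms
      by (intro nn_integral_mono)
         (auto split: split_indicator intro!: ennreal_leI divide_right_mono power_mono
               simp: std_normal_density_def)
    finally show ?thesis by (simp add: Phi_uminus_conv)
  qed
  then have "?d / u \<le> Phi (- u)"
    by (simp add: ennreal_le_iff Phi_nonneg)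
  moreover have "exp (- 3 / 2) * std_normal_density u / u \<le> ?d / u"
    using calculation(1) assms by (intro divide_right_mono) auto
  ultimately show ?thesis by linarith
qed

lemma Phi_pos: "0 < Phi x"
proof -
  have "0 < exp (- 3 / 2) * std_normal_density (max 1 (- x)) / max 1 (- x)"
    by (intro divide_pos_pos mult_pos_pos normal_density_pos) auto
  also have "\<dots> \<le> Phi (- max 1 (- x))"
    by (rule Phi_tail_lower) simp
  also have "\<dots> \<le> Phi x"
    by (rule Phi_mono) simp
  finally show ?thesis .
qed

lemma prob_greaterThan: "measure std_normal_distribution {x<..} = 1 - Phi x"
proof -
  have "measure std_normal_distribution (UNIV - {..x}) = 1 - Phi x"
    using std_normal.prob_compl[of "{..x}"] by (simp add: Phi_def cdf_def)
  moreover have "UNIV - {..x} = {x<..}" by auto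
  ultimately show ?thesis by simp
qed

lemma Phi_less_1: "Phi x < 1"
proof -
  have "0 < measure std_normal_distribution {x + 1..}"
    by (simp add: std_normal_reflect Phi_pos)
  also have "\<dots> \<le> measure std_normal_distribution {x<..}"
    by (intro std_normal.finite_measure_mono) auto
  finally show ?thesis by (simp add: prob_greaterThan)
qed

lemma isCont_Phi: "isCont Phi x"
proof -
  have "emeasure std_normal_distribution {x} = 0"
    by (simp add: emeasure_density)
  then show ?thesis
    unfolding Phi_def std_normal.isCont_cdf by (simp add: measure_def)
qed

lemma Phi_measurable [measurable]: "Phi \<in> borel_measurable borel"
  by (rule borel_measurable_mono) (simp add: mono_def Phi_mono)

text \<open>By continuity of \<open>\<Phi>\<close>, the p-value of a standard Gaussian variable is uniformly distributed.\<close>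

lemma prob_Phi_ge:
  assumes "0 \<le> r" "r < 1"
  shows "1 - r \<le> measure std_normal_distribution {x. r \<le> Phi x}"
proof (cases "r = 0")
  case True
  then show ?thesis using std_normal.prob_space by (simp add: Phi_nonneg)
next
  case False
  with assms have "r > 0" by simp
  have "\<forall>\<^sub>F x in at_bot. Phi x < r"
    using std_normal.cdf_lim_at_bot \<open>r > 0\<close> unfolding Phi_def by (rule order_tendstoD)
  then obtain a where a: "Phi a < r"
    by (auto simp: eventually_at_bot_linorder)
  have "\<forall>\<^sub>F x in at_top. r < Phi x"
    using std_normal.cdf_lim_at_top_prob \<open>r < 1\<close> unfolding Phi_def by (rule order_tendstoD)
  then obtain b where b: "r < Phi b"
    by (auto simp: eventually_at_top_linorder)
  have "a \<le> b" using a b Phi_mono[of b a] by (cases "a \<le> b") auto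
  then obtain z where z: "Phi z = r"
    using IVT[of Phi a r b] a b isCont_Phi by auto
  have "1 - r = measure std_normal_distribution {z<..}"
    by (simp add: prob_greaterThan z)
  also have "\<dots> \<le> measure std_normal_distribution {x. r \<le> Phi x}"
    using z by (intro std_normal.finite_measure_mono) (auto intro!: Phi_mono)
  finally show ?thesis .
qed

section \<open>Countably many independent events\<close>

text \<open>The infinite product is reached by continuity from above along an exhaustion of the index
  set by finite sets.\<close>

lemma (in product_prob_space) prob_PiM_Ball_ge:
  assumes I: "countable I"
    and E: "\<And>i. i \<in> I \<Longrightarrow> E i \<in> sets (M i)"
    and c: "\<And>J. finite J \<Longrightarrow> J \<subseteq> I \<Longrightarrow> c \<le> (\<Prod>i\<in>J. measure (M i) (E i))"
  shows "c \<le> measure (PiM I M) {x \<in> space (PiM I M). \<forall>i\<in>I. x i \<in> E i}"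
proof -
  define J where "J k = {i\<in>I. to_nat_on I i \<le> k}" for k
  have fin: "finite (J k)" for k
  proof (rule finite_imageD)
    show "finite (to_nat_on I ` J k)"
      by (rule finite_subset[of _ "{..k}"]) (auto simp: J_def)
    show "inj_on (to_nat_on I) (J k)"
      using inj_on_to_nat_on[OF I] by (rule inj_on_subset) (auto simp: J_def)
  qed
  have J: "J k \<subseteq> I" for k by (auto simp: J_def)
  define B where "B k = {x \<in> space (PiM I M). \<forall>i\<in>J k. x i \<in> E i}" for k
  have B_eq: "B k = prod_emb I M (J k) (Pi\<^sub>E (J k) E)" for k
    using J[of k] unfolding B_def prod_emb_def by (auto simp: space_PiM Pi_iff PiE_iff extensional_def)
  have "measure (PiM I M) (B k) = (\<Prod>i\<in>J k. measure (M i) (E i))" for k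
    unfolding B_eq using J[of k] fin E by (intro measure_PiM_emb) auto
  then have ge: "c \<le> measure (PiM I M) (B k)" for k
    using c[OF fin J] by simp
  have "(\<lambda>k. measure (PiM I M) (B k)) \<longlonglongrightarrow> measure (PiM I M) (\<Inter>k. B k)"
  proof (rule P.finite_Lim_measure_decseq)
    show "range B \<subseteq> sets (PiM I M)"
      unfolding B_eq using J fin E by (auto intro!: sets_PiM_I)
    show "decseq B"
      by (rule decseq_SucI) (auto simp: B_def J_def)
  qed
  then have "c \<le> measure (PiM I M) (\<Inter>k. B k)"
    using ge by (intro LIMSEQ_le_const) auto
  also have "(\<Inter>k. B k) = {x \<in> space (PiM I M). \<forall>i\<in>I. x i \<in> E i}"
    by (auto simp: B_def J_def)
  finally show ?thesis .
qed

section \<open>The test on the p-value scale\<close>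

text \<open>The smallest p-value of one observation that the test accepts, when the scale has \<open>n\<close>
  grid points and prior weight \<open>w\<close>. It is \<open>0\<close> for \<open>w = 0\<close>, so a scale without mass never
  rejects.\<close>

definition cutoff :: "real \<Rightarrow> real \<Rightarrow> real \<Rightarrow> real" where
  "cutoff q n w = w / (w + n * exp q)"

lemma n_scale_ge_1: "h \<in> scales \<Longrightarrow> 1 \<le> n_scale h"
proof -
  assume "h \<in> scales"
  then obtain k where "k \<ge> 1" "h = (1 / 2) ^ k" by (auto simp: scales_def)
  then show ?thesis
    by (cases k) (auto simp: n_scale_def power_one_over)
qed

lemma grid_nonempty: "h \<in> scales \<Longrightarrow> grid h \<noteq> {}"
  using n_scale_ge_1[of h] n_scale_eq_card[of h] by auto

lemma sigma_scale_pos: "\<sigma> > 0 \<Longrightarrow> h \<in> scales \<Longrightarrow> 0 < sigma_scale \<sigma> h"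
  by (auto simp: sigma_scale_def scales_def)

lemma countable_indices: "countable indices"
  unfolding indices_def by (intro countable_SIGMA countable_scales countable_finite finite_grid)

lemma ln_S_le_iff_cutoff_le:
  assumes "n > 0" "w > 0"
  shows "ln (1 / n * S v) + ln w \<le> q \<longleftrightarrow> cutoff q n w \<le> Phi v"
proof -
  have S: "S v > 0"
    using Phi_pos[of v] Phi_less_1[of v] by (simp add: S_def field_simps)
  have "ln (1 / n * S v) + ln w = ln (1 / n * S v * w)"
    using assms S by (subst ln_mult) auto
  then have "ln (1 / n * S v) + ln w \<le> q \<longleftrightarrow> ln (1 / n * S v * w) \<le> q"
    by simp
  also have "\<dots> \<longleftrightarrow> 1 / n * S v * w \<le> exp q"
    using assms S exp_le_cancel_iff[of "ln (1 / n * S v * w)" q] by simp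
  also have "\<dots> \<longleftrightarrow> S v \<le> n * exp q / w"
    using assms by (simp add: field_simps)
  also have "\<dots> \<longleftrightarrow> 1 / Phi v \<le> (w + n * exp q) / w"
    using assms by (simp add: S_def add_divide_distrib algebra_simps)
  also have "\<dots> \<longleftrightarrow> cutoff q n w \<le> Phi v"
    using assms Phi_pos[of v] add_pos_pos[of w "n * exp q"] unfolding cutoff_def by (simp add: field_simps)
  finally show ?thesis .
qed

lemma map_statistic_le_iff:
  "map_statistic \<sigma> p y \<le> ereal q \<longleftrightarrow>
     (\<forall>(h, t)\<in>indices. cutoff q (n_scale h) (pmf p h) \<le> Phi (y (h, t) / sigma_scale \<sigma> h))"
proof -
  have "ereal (Z_M \<sigma> h y) + eln (pmf p h) \<le> ereal q \<longleftrightarrow>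
      (\<forall>t\<in>grid h. cutoff q (n_scale h) (pmf p h) \<le> Phi (y (h, t) / sigma_scale \<sigma> h))"
    if h: "h \<in> scales" for h
  proof (cases "pmf p h = 0")
    case True
    then show ?thesis by (simp add: eln_def cutoff_def Phi_nonneg)
  next
    case False
    then have w: "pmf p h > 0" by (simp add: pmf_nonneg order_less_le)
    have n: "n_scale h > 0" using n_scale_ge_1[OF h] by simp
    have "ereal (Z_M \<sigma> h y) + eln (pmf p h) \<le> ereal q \<longleftrightarrow> Z_M \<sigma> h y \<le> q - ln (pmf p h)"
      using False by (simp add: eln_def algebra_simps)
    also have "\<dots> \<longleftrightarrow> (\<forall>t\<in>grid h. ln (1 / n_scale h * S (y (h, t) / sigma_scale \<sigma> h)) \<le> q - ln (pmf p h))"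
      unfolding Z_M_def using finite_grid[OF h] grid_nonempty[OF h] by simp
    also have "\<dots> \<longleftrightarrow> (\<forall>t\<in>grid h. cutoff q (n_scale h) (pmf p h) \<le> Phi (y (h, t) / sigma_scale \<sigma> h))"
      unfolding ln_S_le_iff_cutoff_le[OF n w, symmetric] by (simp add: algebra_simps)
    finally show ?thesis .
  qed
  then show ?thesis
    unfolding map_statistic_def SUP_le_iff indices_def by auto
qed

lemma acceptance_prob_eq:
  assumes "\<sigma> > 0"
  shows "\<P>(y in obs_law \<sigma> \<Theta>. map_statistic \<sigma> p y \<le> ereal q) =
    measure noise {\<xi> \<in> space noise. \<forall>(h, t)\<in>indices.
      cutoff q (n_scale h) (pmf p h) \<le> Phi (\<Theta> (h, t) / sigma_scale \<sigma> h + \<xi> (h, t))}"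
proof -
  let ?f = "\<lambda>\<xi>. \<lambda>(h, t)\<in>indices. \<Theta> (h, t) + sigma_scale \<sigma> h * \<xi> (h, t)"
  let ?A = "{y \<in> space (obs_law \<sigma> \<Theta>). map_statistic \<sigma> p y \<le> ereal q}"
  have "?A \<in> sets (obs_law \<sigma> \<Theta>)"
    using map_statistic_measurable[of \<sigma> p \<Theta>] by measurable
  then have A: "?A \<in> sets (PiM indices (\<lambda>_. borel))"
    by (simp add: obs_law_def)
  have "measure (obs_law \<sigma> \<Theta>) ?A = measure noise (?f -` ?A \<inter> space noise)"
    using measure_distr[OF noise_shift_measurable A] by (simp add: obs_law_def)
  also have "?f -` ?A \<inter> space noise = {\<xi> \<in> space noise. \<forall>(h, t)\<in>indices.
      cutoff q (n_scale h) (pmf p h) \<le> Phi (\<Theta> (h, t) / sigma_scale \<sigma> h + \<xi> (h, t))}"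
  proof -
    have "?f \<xi> \<in> space (obs_law \<sigma> \<Theta>)" if "\<xi> \<in> space noise" for \<xi>
      using that measurable_space[OF noise_shift_measurable] by (simp add: obs_law_def)
    moreover have "(\<Theta> (h, t) + sigma_scale \<sigma> h * \<xi> (h, t)) / sigma_scale \<sigma> h
        = \<Theta> (h, t) / sigma_scale \<sigma> h + \<xi> (h, t)" if "(h, t) \<in> indices" for h t \<xi>
    proof -
      have "sigma_scale \<sigma> h \<noteq> 0"
        using that sigma_scale_pos[OF assms, of h] by (auto simp: indices_def)
      then show ?thesis by (simp add: add_divide_distrib)
    qed
    ultimately show ?thesis
      by (auto simp: map_statistic_le_iff split: prod.splits)
  qed
  finally show ?thesis .
qed

text \<open>By choice of the level, \<open>1 - r\<close> equals \<open>1 / (1 + l w / n)\<close> with \<open>exp (-l) = 1 - \<alpha>\<close>. The power form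
  turns the product over all coordinates into a sum of weights.\<close>

lemma one_minus_cutoff_ge:
  assumes "0 < \<alpha>" "\<alpha> < 1" "n \<ge> 1" "w \<ge> 0"
  shows "(1 - \<alpha>) powr (w / n) \<le> 1 - cutoff (q_level \<alpha>) n w"
proof -
  define l where "l = ln (1 / (1 - \<alpha>))"
  have l: "l > 0" using assms by (simp add: l_def)
  have e: "exp (q_level \<alpha>) = 1 / l"
    using l by (simp add: q_level_def l_def[symmetric] exp_minus field_simps)
  have "1 - cutoff (q_level \<alpha>) n w = 1 / (1 + l * (w / n))"
    using assms l add_pos_nonneg[of n "l * w"] unfolding cutoff_def e by (simp add: field_simps)
  moreover have "(1 - \<alpha>) powr (w / n) = 1 / exp (l * (w / n))"
    using assms by (simp add: powr_def l_def ln_div exp_minus field_simps)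
  moreover have "1 + l * (w / n) \<le> exp (l * (w / n))"
    by (rule exp_ge_add_one_self)
  moreover have "1 + l * (w / n) > 0"
    using assms l by (intro add_pos_nonneg) auto
  ultimately show ?thesis
    by (simp add: frac_le)
qed

lemma sum_weights_le_1:
  assumes "finite J" "J \<subseteq> indices"
  shows "(\<Sum>(h, t)\<in>J. pmf p h / n_scale h) \<le> 1"
proof -
  let ?H = "fst ` J"
  have H: "finite ?H" "?H \<subseteq> scales" using assms by (auto simp: indices_def)
  have "(\<Sum>(h, t)\<in>J. pmf p h / n_scale h) \<le> (\<Sum>(h, t)\<in>(SIGMA h:?H. grid h). pmf p h / n_scale h)"
  proof (rule sum_mono2)
    show "finite (SIGMA h:?H. grid h)" using H by (intro finite_SigmaI finite_grid) auto
    show "J \<subseteq> (SIGMA h:?H. grid h)" using assms by (force simp: indices_def)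
    fix i assume "i \<in> (SIGMA h:?H. grid h) - J"
    then have "fst i \<in> scales" using H by auto
    then show "0 \<le> (case i of (h, t) \<Rightarrow> pmf p h / n_scale h)"
      using n_scale_ge_1[of "fst i"] by (auto split: prod.split)
  qed
  also have "\<dots> = (\<Sum>h\<in>?H. \<Sum>t\<in>grid h. pmf p h / n_scale h)"
    using H by (intro sum.Sigma[symmetric] ballI finite_grid) auto
  also have "\<dots> = (\<Sum>h\<in>?H. pmf p h)"
  proof (intro sum.cong refl)
    fix h assume "h \<in> ?H"
    then have h: "h \<in> scales" using H by blast
    then show "(\<Sum>t\<in>grid h. pmf p h / n_scale h) = pmf p h"
      using n_scale_ge_1[OF h] n_scale_eq_card[OF h] by simp
  qed
  also have "\<dots> = measure (measure_pmf p) ?H"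
    using H by (simp add: measure_measure_pmf_finite)
  also have "\<dots> \<le> 1" by simp
  finally show ?thesis .
qed

section \<open>Type II error of a single alternative\<close>

lemma bdd_above_acceptance:
  "bdd_above ((\<lambda>\<Theta>. \<P>(y in obs_law \<sigma> \<Theta>. map_statistic \<sigma> p y \<le> ereal q)) ` X)"
  by (rule bdd_aboveI2[where M = 1]) (rule prob_space.prob_le_1[OF prob_space_obs_law])

lemma spike_in_alternatives: "(\<lambda>i. if i = (h, t) then - A else 0) \<in> alternatives h t A"
  by (simp add: alternatives_def)

lemma beta_M_nonneg: "0 \<le> beta_M \<sigma> \<alpha> p h t A"
  unfolding beta_M_def
  by (rule cSUP_upper2[OF bdd_above_acceptance spike_in_alternatives]) simp

lemma beta_M_le_1: "beta_M \<sigma> \<alpha> p h t A \<le> 1"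
  unfolding beta_M_def using spike_in_alternatives
  by (intro cSUP_least prob_space.prob_le_1[OF prob_space_obs_law]) blast

text \<open>The least favourable array has zeros off the spike: there the acceptance probabilities multiply
  to at least \<open>1 - \<alpha>\<close>, and the spike coordinate contributes \<open>1 - \<Phi>(x)\<close>.\<close>

lemma beta_M_lower:
  assumes \<sigma>: "\<sigma> > 0" and \<alpha>: "0 < \<alpha>" "\<alpha> < 1" and ht: "(h, t) \<in> indices"
    and below: "cutoff (q_level \<alpha>) (n_scale h) (pmf p h) \<le> Phi (x - A / sigma_scale \<sigma> h)"
  shows "(1 - \<alpha>) * (1 - Phi x) \<le> beta_M \<sigma> \<alpha> p h t A"
proof -
  define \<Theta> where "\<Theta> = (\<lambda>i. if i = (h, t) then - A else 0 :: real)"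
  define r where "r i = cutoff (q_level \<alpha>) (n_scale (fst i)) (pmf p (fst i))" for i :: "real \<times> real"
  define E where "E i = {\<xi>. r i \<le> Phi (\<Theta> i / sigma_scale \<sigma> (fst i) + \<xi>)}" for i
  define v where "v = 1 - Phi x"
  define g where "g i = (1 - \<alpha>) powr (pmf p (fst i) / n_scale (fst i))" for i :: "real \<times> real"
  have v: "0 \<le> v" "v \<le> 1" using Phi_le_1 Phi_nonneg by (auto simp: v_def)
  have n: "n_scale (fst i) \<ge> 1" if "i \<in> indices" for i
    using that n_scale_ge_1 by (auto simp: indices_def)
  interpret product_prob_space "\<lambda>_. std_normal_distribution" indices
    by unfold_locales
  have E_prob: "(if i = (h, t) then v else 1) * g i \<le> measure std_normal_distribution (E i)"
    if i: "i \<in> indices" for i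
  proof (cases "i = (h, t)")
    case True
    have "v \<le> measure std_normal_distribution (E i)"
    proof -
      have "{x<..} \<subseteq> E i"
        using below True Phi_mono[of "x - A / sigma_scale \<sigma> h"]
        by (auto simp: E_def r_def \<Theta>_def intro: order_trans)
      then have "measure std_normal_distribution {x<..} \<le> measure std_normal_distribution (E i)"
        by (intro std_normal.finite_measure_mono) (auto simp: E_def)
      then show ?thesis by (simp add: prob_greaterThan v_def)
    qed
    moreover have "g i \<le> 1"
      unfolding g_def using \<alpha> n[OF i] by (intro powr_le1) auto
    ultimately show ?thesis
      using True v mult_left_le[of "g i" v] by simp
  next
    case False
    have "g i \<le> 1 - r i"
      unfolding g_def r_def using \<alpha> n[OF i] by (intro one_minus_cutoff_ge) auto
    also have "\<dots> \<le> measure std_normal_distribution {\<xi>. r i \<le> Phi \<xi>}"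
    proof (rule prob_Phi_ge)
      show "0 \<le> r i" using n[OF i] by (auto simp: r_def cutoff_def)
      show "r i < 1" using n[OF i] add_nonneg_pos[of "pmf p (fst i)" "n_scale (fst i) * exp (q_level \<alpha>)"]
        by (auto simp: r_def cutoff_def)
    qed
    finally show ?thesis using False by (simp add: E_def \<Theta>_def)
  qed
  have "(1 - \<alpha>) * v \<le> measure noise {\<xi> \<in> space noise. \<forall>i\<in>indices. \<xi> i \<in> E i}"
    unfolding noise_def
  proof (rule prob_PiM_Ball_ge[OF countable_indices])
    show "E i \<in> sets std_normal_distribution" for i by (simp add: E_def)
    fix J assume J: "finite J" "J \<subseteq> indices"
    have "(1 - \<alpha>) powr 1 \<le> (1 - \<alpha>) powr (\<Sum>i\<in>J. pmf p (fst i) / n_scale (fst i))"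
      using \<alpha> sum_weights_le_1[OF J, of p]
      by (intro powr_mono') (auto simp: case_prod_unfold)
    also have "\<dots> = (\<Prod>i\<in>J. g i)"
      using \<alpha> J by (simp add: g_def powr_sum)
    finally have "(1 - \<alpha>) * v \<le> (\<Prod>i\<in>J. g i) * (\<Prod>i\<in>J. if i = (h, t) then v else 1)"
      using \<alpha> v J by (intro mult_mono) (auto simp: prod.delta g_def intro!: prod_nonneg)
    also have "\<dots> = (\<Prod>i\<in>J. (if i = (h, t) then v else 1) * g i)"
      by (simp add: prod.distrib mult.commute)
    also have "\<dots> \<le> (\<Prod>i\<in>J. measure std_normal_distribution (E i))"
    proof (rule prod_mono)
      fix i assume "i \<in> J"
      then have "i \<in> indices" using J by blast
      then show "0 \<le> (if i = (h, t) then v else 1) * g i \<and>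
          (if i = (h, t) then v else 1) * g i \<le> measure std_normal_distribution (E i)"
        using E_prob v by (auto simp: g_def)
    qed
    finally show "(1 - \<alpha>) * v \<le> (\<Prod>i\<in>J. measure std_normal_distribution (E i))" .
  qed
  also have "\<dots> = \<P>(y in obs_law \<sigma> \<Theta>. map_statistic \<sigma> p y \<le> ereal (q_level \<alpha>))"
    unfolding acceptance_prob_eq[OF \<sigma>] by (simp add: E_def r_def case_prod_unfold)
  also have "\<dots> \<le> beta_M \<sigma> \<alpha> p h t A"
    unfolding beta_M_def \<Theta>_def by (rule cSUP_upper[OF spike_in_alternatives bdd_above_acceptance])
  finally show ?thesis by (simp add: v_def)
qed

text \<open>Acceptance forces the p-value of the spike coordinate above the cutoff, hence its noise
  above \<open>M\<close>, whatever the other parameters are.\<close>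

lemma beta_M_upper:
  assumes \<sigma>: "\<sigma> > 0" and ht: "(h, t) \<in> indices"
    and above: "Phi (M - A / sigma_scale \<sigma> h) < cutoff (q_level \<alpha>) (n_scale h) (pmf p h)"
  shows "beta_M \<sigma> \<alpha> p h t A \<le> 1 - Phi M"
  unfolding beta_M_def
proof (rule cSUP_least)
  show "alternatives h t A \<noteq> {}" using spike_in_alternatives by blast
  fix \<Theta> assume "\<Theta> \<in> alternatives h t A"
  then have \<Theta>: "\<Theta> (h, t) = - A" by (simp add: alternatives_def)
  interpret product_prob_space "\<lambda>_. std_normal_distribution" indices
    by unfold_locales
  have "\<P>(y in obs_law \<sigma> \<Theta>. map_statistic \<sigma> p y \<le> ereal (q_level \<alpha>))
      \<le> measure noise {\<xi> \<in> space noise. \<xi> (h, t) \<in> {M<..}}"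
    unfolding acceptance_prob_eq[OF \<sigma>] noise_def
  proof (rule P.finite_measure_mono)
    show "{\<xi> \<in> space (PiM indices (\<lambda>_. std_normal_distribution)). \<xi> (h, t) \<in> {M<..}}
        \<in> sets (PiM indices (\<lambda>_. std_normal_distribution))"
      using ht by measurable
    show "{\<xi> \<in> space (PiM indices (\<lambda>_. std_normal_distribution)). \<forall>(h, t)\<in>indices.
          cutoff (q_level \<alpha>) (n_scale h) (pmf p h) \<le> Phi (\<Theta> (h, t) / sigma_scale \<sigma> h + \<xi> (h, t))}
        \<subseteq> {\<xi> \<in> space (PiM indices (\<lambda>_. std_normal_distribution)). \<xi> (h, t) \<in> {M<..}}"
    proof safe
      fix \<xi> assume "\<forall>(h, t)\<in>indices.
          cutoff (q_level \<alpha>) (n_scale h) (pmf p h) \<le> Phi (\<Theta> (h, t) / sigma_scale \<sigma> h + \<xi> (h, t))"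
      with ht \<Theta> above have "Phi (M - A / sigma_scale \<sigma> h) < Phi (\<xi> (h, t) - A / sigma_scale \<sigma> h)"
        by fastforce
      then show "M < \<xi> (h, t)"
        using Phi_mono[of "\<xi> (h, t) - A / sigma_scale \<sigma> h" "M - A / sigma_scale \<sigma> h"]
        by (cases "\<xi> (h, t) \<le> M") auto
    qed
  qed
  also have "\<dots> = measure std_normal_distribution {M<..}"
    unfolding noise_def measure_def using emeasure_PiM_Collect_single[OF ht, of "{M<..}"] by simp
  finally show "\<P>(y in obs_law \<sigma> \<Theta>. map_statistic \<sigma> p y \<le> ereal (q_level \<alpha>)) \<le> 1 - Phi M"
    by (simp add: prob_greaterThan)
qed

section \<open>Comparing the cutoff with Gaussian tails\<close>

lemma cutoff_le_exp:
  assumes "n > 0" "w > 0"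
  shows "cutoff q n w \<le> exp (- (q + ln n + ln (1 / w)))"
proof -
  have "exp (- (q + ln n + ln (1 / w))) = w / (n * exp q)"
    using assms by (simp add: exp_minus exp_add exp_diff ln_div field_simps)
  moreover have "cutoff q n w \<le> w / (n * exp q)"
    unfolding cutoff_def using assms by (intro divide_left_mono mult_pos_pos add_pos_pos) auto
  ultimately show ?thesis by simp
qed

lemma cutoff_ge_exp:
  assumes "n > 0" "w > 0" "w \<le> n * exp q"
  shows "exp (- (q + ln n + ln (1 / w))) / 2 \<le> cutoff q n w"
proof -
  have "exp (- (q + ln n + ln (1 / w))) = w / (n * exp q)"
    using assms by (simp add: exp_minus exp_add exp_diff ln_div field_simps)
  moreover have "w / (2 * (n * exp q)) \<le> cutoff q n w"
    unfolding cutoff_def using assms by (intro divide_left_mono mult_pos_pos add_pos_pos) auto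
  ultimately show ?thesis by simp
qed

text \<open>If \<open>u\<^sup>2 = 2 L - ln (4 \<pi> L) - 2 c\<close>, then \<open>\<phi>(u)\<close> is \<open>exp (c - L) sqrt (2 L)\<close>, and dividing by
  \<open>u \<le> sqrt (2 L)\<close> leaves \<open>exp (c - L)\<close>.\<close>

lemma Phi_tail_ge_exp:
  assumes "u \<ge> 1" "L \<ge> 1" "c \<ge> 0" and u: "u\<^sup>2 \<le> 2 * L - ln (4 * pi * L) - 2 * c"
  shows "exp (c - 3 / 2 - L) \<le> Phi (- u)"
proof -
  have pi: "4 * pi * L \<ge> 1"
    using assms pi_gt3 mult_mono[of 1 "4 * pi" 1 L] by auto
  then have "u\<^sup>2 \<le> 2 * L" using u \<open>c \<ge> 0\<close> ln_ge_zero[OF pi] by linarith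
  then have uL: "u \<le> sqrt (2 * L)" using assms by (intro real_le_rsqrt) auto
  have "exp (c - 3 / 2 - L) = exp (- 3 / 2) * exp (c - L)"
    by (simp add: mult_exp_exp)
  also have "exp (c - L) = exp (c - L) * (sqrt (4 * pi * L) / (sqrt (2 * pi) * sqrt (2 * L)))"
  proof -
    have "sqrt (2 * pi) * sqrt (2 * L) = sqrt (4 * pi * L)"
      by (simp add: real_sqrt_mult[symmetric] mult.assoc)
    moreover have "sqrt (4 * pi * L) > 0" using assms by simp
    ultimately show ?thesis using assms by simp
  qed
  also have "\<dots> \<le> exp (c - L) * (sqrt (4 * pi * L) / (sqrt (2 * pi) * u))"
    using uL assms by (intro mult_left_mono divide_left_mono mult_pos_pos) auto
  also have "\<dots> = exp (c - L + ln (4 * pi * L) / 2) / (sqrt (2 * pi) * u)"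
    using assms by (simp add: exp_add ln_sqrt[symmetric])
  also have "\<dots> \<le> exp (- u\<^sup>2 / 2) / (sqrt (2 * pi) * u)"
    using u assms by (intro divide_right_mono) auto
  also have "\<dots> = std_normal_density u / u"
    by (simp add: std_normal_density_def)
  finally have "exp (c - 3 / 2 - L) \<le> exp (- 3 / 2) * (std_normal_density u / u)"
    by simp
  with Phi_tail_lower[OF \<open>u \<ge> 1\<close>] show ?thesis by simp
qed

text \<open>The counterpart of the previous lemma. The condition \<open>ln (4 \<pi> L) \<le> L\<close> gives \<open>b \<ge> sqrt L\<close>,
  which is enough to cancel the square root coming from the logarithmic term.\<close>

lemma Phi_tail_le_exp:
  assumes "b > 0" "L \<ge> 1" "ln (4 * pi * L) \<le> L" "c \<ge> 0"
    and b: "2 * L - ln (4 * pi * L) + 2 * c \<le> b\<^sup>2"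
  shows "Phi (- b) \<le> 2 * exp (- L - c)"
proof -
  have "L \<le> b\<^sup>2" using assms by linarith
  then have bL: "sqrt L \<le> b" using assms by (intro real_le_lsqrt) auto
  have "Phi (- b) \<le> std_normal_density b / b"
    using Phi_tail_upper[OF \<open>b > 0\<close>] .
  also have "\<dots> = exp (- b\<^sup>2 / 2) / (sqrt (2 * pi) * b)"
    by (simp add: std_normal_density_def)
  also have "\<dots> \<le> exp (- L - c + ln (4 * pi * L) / 2) / (sqrt (2 * pi) * b)"
    using b assms by (intro divide_right_mono) auto
  also have "\<dots> = exp (- L - c) * sqrt (4 * pi * L) / (sqrt (2 * pi) * b)"
    using assms by (simp add: exp_add ln_sqrt[symmetric])
  also have "\<dots> \<le> exp (- L - c) * sqrt (4 * pi * L) / (sqrt (2 * pi) * sqrt L)"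
    using bL assms by (intro divide_left_mono mult_left_mono mult_pos_pos) auto
  also have "\<dots> = exp (- L - c) * sqrt 2"
    using assms by (simp add: real_sqrt_mult) (simp add: real_sqrt_mult[symmetric] field_simps)
  also have "\<dots> \<le> exp (- L - c) * 2"
    using sqrt2_less_2 by (intro mult_left_mono) auto
  finally show ?thesis by (simp add: mult.commute)
qed

text \<open>The amplitude condition makes \<open>(a - x)\<^sup>2\<close> smaller than \<open>R\<^sub>h\<close> by \<open>(\<epsilon> / 2) ln H\<close>, so the tail at
  \<open>a - x\<close> gains the factor \<open>exp ((\<epsilon> / 4) ln H)\<close>, more than the factor \<open>exp ((\<epsilon> / 8) ln H)\<close> that the
  deviation of the weight can cost. For \<open>a - x < 1\<close> the tail is bounded below while the
  cutoff tends to \<open>0\<close>.\<close>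

lemma cutoff_le_Phi_of_small_amplitude:
  fixes q x \<epsilon> :: real
  assumes "\<epsilon> > 0"
  shows "\<forall>\<^sub>F H in at_top. \<forall>h\<in>scales. \<forall>w a. w > 0 \<longrightarrow>
    \<bar>H - ln (1 / w)\<bar> \<le> \<epsilon> / 8 * ln H \<longrightarrow> (a - x)\<^sup>2 + \<epsilon> * ln H - R h q H \<le> \<epsilon> / 2 * ln H \<longrightarrow>
    cutoff q (n_scale h) w \<le> Phi (x - a)"
proof -
  have "\<forall>\<^sub>F H in at_top. q + H \<ge> 1" by real_asymp
  moreover have "\<forall>\<^sub>F H in at_top. \<epsilon> / 8 * ln H \<ge> 3 / 2" using assms by real_asymp
  moreover have "\<forall>\<^sub>F H in at_top. \<epsilon> / 8 * ln H - (q + H) \<le> ln (Phi (- 1))" by real_asymp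
  ultimately show ?thesis
  proof eventually_elim
    case (elim H)
    show ?case
    proof (intro ballI allI impI)
      fix h w a :: real
      assume h: "h \<in> scales" and w: "w > 0" and dev: "\<bar>H - ln (1 / w)\<bar> \<le> \<epsilon> / 8 * ln H"
        and a: "(a - x)\<^sup>2 + \<epsilon> * ln H - R h q H \<le> \<epsilon> / 2 * ln H"
      define L where "L = q + ln (n_scale h) + H"
      have n: "n_scale h \<ge> 1" "ln (n_scale h) \<ge> 0" using n_scale_ge_1[OF h] by auto
      have L: "L \<ge> q + H" "L \<ge> 1" using n(2) elim(1) unfolding L_def by linarith+
      have "cutoff q (n_scale h) w \<le> exp (- (q + ln (n_scale h) + ln (1 / w)))"
        using n w by (intro cutoff_le_exp) auto
      also have "\<dots> \<le> exp (\<epsilon> / 8 * ln H - L)"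
        unfolding L_def exp_le_cancel_iff using dev by linarith
      also have "\<dots> \<le> Phi (x - a)"
      proof (cases "a - x \<ge> 1")
        case True
        have "exp (\<epsilon> / 8 * ln H - L) \<le> exp (\<epsilon> / 4 * ln H - 3 / 2 - L)"
          using elim(2) by simp
        also have "\<dots> \<le> Phi (- (a - x))"
          using True L(2) a elim(2) by (intro Phi_tail_ge_exp) (auto simp: R_def L_def)
        finally show ?thesis by simp
      next
        case False
        have "exp (\<epsilon> / 8 * ln H - L) \<le> exp (ln (Phi (- 1)))"
          using elim(3) L(1) by simp
        also have "\<dots> = Phi (- 1)" by (simp add: Phi_pos)
        also have "\<dots> \<le> Phi (x - a)" using False by (intro Phi_mono) simp
        finally show ?thesis .
      qed
      finally show "cutoff q (n_scale h) w \<le> Phi (x - a)" .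
    qed
  qed
qed

text \<open>Completing the square turns the amplitude condition into
  \<open>(a - s)\<^sup>2 \<ge> R\<^sub>h + (\<epsilon> / 2) ln H\<close> with \<open>s = sqrt (\<epsilon> ln H)\<close>. Since \<open>s \<rightarrow> \<infinity>\<close>, the shift \<open>s\<close>
  eventually exceeds the fixed \<open>M\<close>.\<close>

lemma Phi_less_cutoff_of_large_amplitude:
  fixes q M \<epsilon> :: real
  assumes "\<epsilon> > 0"
  shows "\<forall>\<^sub>F H in at_top. \<forall>h\<in>scales. \<forall>w a. w > 0 \<longrightarrow> a > 0 \<longrightarrow>
    \<bar>H - ln (1 / w)\<bar> \<le> \<epsilon> / 8 * ln H \<longrightarrow>
    R h q H + 2 * sqrt (\<epsilon> * ln H) * a - a\<^sup>2 \<le> \<epsilon> / 2 * ln H \<longrightarrow>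
    Phi (M - a) < cutoff q (n_scale h) w"
proof -
  have "\<forall>\<^sub>F L in at_top. ln (4 * pi * L) \<le> L" by real_asymp
  then obtain L0 where L0: "\<And>L. L \<ge> L0 \<Longrightarrow> ln (4 * pi * L) \<le> L"
    by (auto simp: eventually_at_top_linorder)
  have "\<forall>\<^sub>F H in at_top. q + H \<ge> 1" by real_asymp
  moreover have "\<forall>\<^sub>F H in at_top. q + H \<ge> L0" by real_asymp
  moreover have "\<forall>\<^sub>F H in at_top. \<epsilon> * ln H > 0" using assms by real_asymp
  moreover have "\<forall>\<^sub>F H in at_top. q + H > \<epsilon> / 2 * ln H" using assms by real_asymp
  moreover have "\<forall>\<^sub>F H in at_top. q + H \<ge> \<epsilon> / 8 * ln H" using assms by real_asymp
  moreover have "\<forall>\<^sub>F H in at_top. sqrt (\<epsilon> * ln H) \<ge> M" using assms by real_asymp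
  moreover have "\<forall>\<^sub>F H in at_top. \<epsilon> / 8 * ln H > ln 4" using assms by real_asymp
  ultimately show ?thesis
  proof eventually_elim
    case (elim H)
    show ?case
    proof (intro ballI allI impI)
      fix h w a :: real
      assume h: "h \<in> scales" and w: "w > 0" and a_pos: "a > 0"
        and dev: "\<bar>H - ln (1 / w)\<bar> \<le> \<epsilon> / 8 * ln H"
        and a: "R h q H + 2 * sqrt (\<epsilon> * ln H) * a - a\<^sup>2 \<le> \<epsilon> / 2 * ln H"
      define L where "L = q + ln (n_scale h) + H"
      define s where "s = sqrt (\<epsilon> * ln H)"
      define b where "b = a - s"
      have s: "s > 0" "s\<^sup>2 = \<epsilon> * ln H" using elim(3) by (auto simp: s_def)
      have n: "n_scale h \<ge> 1" "ln (n_scale h) \<ge> 0" using n_scale_ge_1[OF h] by auto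
      have L: "L \<ge> q + H" "L \<ge> 1" "ln (4 * pi * L) \<le> L"
      proof -
        show "L \<ge> q + H" "L \<ge> 1" using n(2) elim(1) unfolding L_def by linarith+
        show "ln (4 * pi * L) \<le> L" using n(2) elim(2) unfolding L_def by (intro L0) linarith
      qed
      have "b\<^sup>2 = a\<^sup>2 - 2 * s * a + s\<^sup>2"
        by (simp add: b_def power2_diff algebra_simps)
      then have b_sq: "2 * L - ln (4 * pi * L) + 2 * (\<epsilon> / 4 * ln H) \<le> b\<^sup>2"
        using a s by (simp add: R_def L_def s_def[symmetric])
      \<comment> \<open>The square alone does not give the sign of \<open>b\<close>. As \<open>a\<close> is positive, a negative \<open>b\<close> would
        be at most \<open>s\<close> in modulus, whereas \<open>b\<^sup>2\<close> is of order \<open>H\<close> and \<open>s\<^sup>2\<close> of order \<open>ln H\<close>.\<close>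
      have "b > 0"
      proof (rule ccontr)
        assume "\<not> b > 0"
        then have "\<bar>b\<bar> \<le> s" using a_pos by (simp add: b_def)
        then have "b\<^sup>2 \<le> s\<^sup>2" using s abs_le_square_iff[of b s] by simp
        then have "L \<le> \<epsilon> / 2 * ln H" using b_sq s L by linarith
        then show False using elim(4) L by linarith
      qed
      have "Phi (M - a) \<le> Phi (- b)"
        using elim(6) by (intro Phi_mono) (simp add: b_def s_def)
      also have "\<dots> \<le> 2 * exp (- L - \<epsilon> / 4 * ln H)"
        using \<open>b > 0\<close> L b_sq elim(3) by (intro Phi_tail_le_exp) auto
      \<comment> \<open>One factor 2 comes from the tail bound, the other from the lower bound on the cutoff.\<close>
      also have "\<dots> < exp (- L - \<epsilon> / 8 * ln H) / 2"
      proof -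
        have "exp (ln 4) * exp (- L - \<epsilon> / 4 * ln H) < exp (- L - \<epsilon> / 8 * ln H)"
          unfolding mult_exp_exp using elim(7) by simp
        then show ?thesis by simp
      qed
      also have "\<dots> \<le> exp (- (q + ln (n_scale h) + ln (1 / w))) / 2"
      proof -
        have "exp (- L - \<epsilon> / 8 * ln H) \<le> exp (- (q + ln (n_scale h) + ln (1 / w)))"
          unfolding L_def exp_le_cancel_iff using dev by linarith
        then show ?thesis by (rule divide_right_mono) simp
      qed
      also have "\<dots> \<le> cutoff q (n_scale h) w"
      proof (rule cutoff_ge_exp)
        have "ln w = - ln (1 / w)" using w by (simp add: ln_div)
        also have "\<dots> \<le> q" using dev elim(5) by linarith
        finally have "exp (ln w) \<le> exp q" by simp
        then have "w \<le> exp q" using w by simp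
        also have "\<dots> \<le> n_scale h * exp q" using n by simp
        finally show "w \<le> n_scale h * exp q" .
      qed (use n w in auto)
      finally show "Phi (M - a) < cutoff q (n_scale h) w" .
    qed
  qed
qed

section \<open>Averaging over the scales\<close>

lemma pmf_has_sum_measure: "(pmf p has_sum measure (measure_pmf p) X) X"
proof -
  have "measure (measure_pmf p) X = infsum (pmf p) X"
    unfolding measure_pmf_conv_infsetsum by (rule infsetsum_infsum) (rule pmf_abs_summable)
  moreover have "pmf p summable_on X"
    using pmf_abs_summable[of p X] by (simp flip: abs_summable_equivalent)
  ultimately show ?thesis by simp
qed

lemma measure_pmf_scales:
  assumes "set_pmf p \<subseteq> scales"
  shows "measure (measure_pmf p) scales = 1"
  using assms by (subst measure_pmf.prob_eq_1) (auto simp: AE_measure_pmf_iff)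

lemma measure_pmf_Int_scales:
  assumes "set_pmf p \<subseteq> scales"
  shows "measure (measure_pmf p) (X \<inter> scales) = measure (measure_pmf p) X"
  using assms by (intro measure_eq_AE) (auto simp: AE_measure_pmf_iff)

lemma avg_beta_M_has_sum:
  "((\<lambda>h. pmf p h / n_scale h * (\<Sum>t\<in>grid h. beta_M \<sigma> \<alpha> p h t (A h)))
     has_sum avg_beta_M \<sigma> \<alpha> p A) scales"
proof -
  have "(\<lambda>h. pmf p h / n_scale h * (\<Sum>t\<in>grid h. beta_M \<sigma> \<alpha> p h t (A h))) summable_on scales"
  proof (rule summable_on_comparison_test)
    show "pmf p summable_on scales"
      using pmf_has_sum_measure by (rule has_sum_imp_summable)
    fix h assume h: "h \<in> scales"
    have "(\<Sum>t\<in>grid h. beta_M \<sigma> \<alpha> p h t (A h)) \<le> n_scale h"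
      using sum_bounded_above[of "grid h" "\<lambda>t. beta_M \<sigma> \<alpha> p h t (A h)" 1] beta_M_le_1
        n_scale_eq_card[OF h] by simp
    then have "pmf p h / n_scale h * (\<Sum>t\<in>grid h. beta_M \<sigma> \<alpha> p h t (A h))
        \<le> pmf p h / n_scale h * n_scale h"
      using n_scale_ge_1[OF h] by (intro mult_left_mono) auto
    then show "pmf p h / n_scale h * (\<Sum>t\<in>grid h. beta_M \<sigma> \<alpha> p h t (A h)) \<le> pmf p h"
      using n_scale_ge_1[OF h] by simp
    show "0 \<le> pmf p h / n_scale h * (\<Sum>t\<in>grid h. beta_M \<sigma> \<alpha> p h t (A h))"
      using n_scale_ge_1[OF h] by (intro mult_nonneg_nonneg sum_nonneg beta_M_nonneg) auto
  qed
  then show ?thesis by (simp add: avg_beta_M_def)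
qed

lemma avg_beta_M_lower:
  assumes supp: "set_pmf p \<subseteq> scales" and "c \<ge> 0"
    and c: "\<And>h t. h \<in> scales \<Longrightarrow> h \<in> G \<Longrightarrow> pmf p h > 0 \<Longrightarrow> t \<in> grid h \<Longrightarrow> c \<le> beta_M \<sigma> \<alpha> p h t (A h)"
  shows "c * measure (measure_pmf p) G \<le> avg_beta_M \<sigma> \<alpha> p A"
proof -
  have "((\<lambda>h. c * pmf p h) has_sum c * measure (measure_pmf p) (G \<inter> scales)) (G \<inter> scales)"
    by (intro has_sum_cmult_right pmf_has_sum_measure)
  then have "c * measure (measure_pmf p) (G \<inter> scales) \<le> avg_beta_M \<sigma> \<alpha> p A"
  proof (rule has_sum_mono_neutral[OF _ avg_beta_M_has_sum])
    fix h assume h: "h \<in> G \<inter> scales \<inter> scales"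
    show "c * pmf p h \<le> pmf p h / n_scale h * (\<Sum>t\<in>grid h. beta_M \<sigma> \<alpha> p h t (A h))"
    proof (cases "pmf p h = 0")
      case False
      then have "n_scale h * c \<le> (\<Sum>t\<in>grid h. beta_M \<sigma> \<alpha> p h t (A h))"
        using h sum_bounded_below[of "grid h" c "\<lambda>t. beta_M \<sigma> \<alpha> p h t (A h)"]
        by (simp add: n_scale_eq_card c order_less_le)
      then have "pmf p h / n_scale h * (n_scale h * c)
          \<le> pmf p h / n_scale h * (\<Sum>t\<in>grid h. beta_M \<sigma> \<alpha> p h t (A h))"
        using h n_scale_ge_1[of h] by (intro mult_left_mono) auto
      then show ?thesis using h n_scale_ge_1[of h] by (simp add: mult.commute)
    qed simp
  next
    fix h assume "h \<in> scales - (G \<inter> scales)"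
    then show "0 \<le> pmf p h / n_scale h * (\<Sum>t\<in>grid h. beta_M \<sigma> \<alpha> p h t (A h))"
      using n_scale_ge_1[of h] by (intro mult_nonneg_nonneg sum_nonneg beta_M_nonneg) auto
  qed auto
  then show ?thesis by (simp add: measure_pmf_Int_scales[OF supp])
qed

lemma avg_beta_M_nonneg: "set_pmf p \<subseteq> scales \<Longrightarrow> 0 \<le> avg_beta_M \<sigma> \<alpha> p A"
  using avg_beta_M_lower[of p 0 UNIV \<sigma> \<alpha> A] by (simp add: beta_M_nonneg)

lemma avg_beta_M_upper:
  assumes supp: "set_pmf p \<subseteq> scales" and "c \<ge> 0"
    and c: "\<And>h t. h \<in> scales \<Longrightarrow> h \<in> G \<Longrightarrow> pmf p h > 0 \<Longrightarrow> t \<in> grid h \<Longrightarrow> beta_M \<sigma> \<alpha> p h t (A h) \<le> c"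
  shows "avg_beta_M \<sigma> \<alpha> p A \<le> c + measure (measure_pmf p) (- G)"
proof -
  have "((\<lambda>h. c * pmf p h) has_sum c * measure (measure_pmf p) scales) scales"
    by (intro has_sum_cmult_right pmf_has_sum_measure)
  moreover have "((\<lambda>h. if h \<in> - G then pmf p h else 0) has_sum measure (measure_pmf p) (- G)) scales"
  proof -
    have "(pmf p has_sum measure (measure_pmf p) (- G \<inter> scales)) (- G \<inter> scales)"
      by (rule pmf_has_sum_measure)
    then have "((\<lambda>h. if h \<in> - G then pmf p h else 0) has_sum measure (measure_pmf p) (- G \<inter> scales)) scales"
      by (subst (asm) has_sum_cong_neutral) auto
    then show ?thesis by (simp only: measure_pmf_Int_scales[OF supp])
  qed
  ultimately have "((\<lambda>h. c * pmf p h + (if h \<in> - G then pmf p h else 0))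
      has_sum (c * measure (measure_pmf p) scales + measure (measure_pmf p) (- G))) scales"
    by (rule has_sum_add)
  then have "avg_beta_M \<sigma> \<alpha> p A \<le> c * measure (measure_pmf p) scales + measure (measure_pmf p) (- G)"
  proof (rule has_sum_mono[OF avg_beta_M_has_sum])
    fix h assume h: "h \<in> scales"
    define d where "d = (if h \<in> G then c else 1)"
    show "pmf p h / n_scale h * (\<Sum>t\<in>grid h. beta_M \<sigma> \<alpha> p h t (A h))
        \<le> c * pmf p h + (if h \<in> - G then pmf p h else 0)"
    proof (cases "pmf p h = 0")
      case False
      then have "(\<Sum>t\<in>grid h. beta_M \<sigma> \<alpha> p h t (A h)) \<le> n_scale h * d"
        using h sum_bounded_above[of "grid h" "\<lambda>t. beta_M \<sigma> \<alpha> p h t (A h)" d]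
        by (simp add: n_scale_eq_card c order_less_le d_def beta_M_le_1)
      then have "pmf p h / n_scale h * (\<Sum>t\<in>grid h. beta_M \<sigma> \<alpha> p h t (A h))
          \<le> pmf p h / n_scale h * (n_scale h * d)"
        using h n_scale_ge_1[of h] by (intro mult_left_mono) auto
      also have "\<dots> = pmf p h * d" using h n_scale_ge_1[of h] by simp
      also have "\<dots> \<le> c * pmf p h + (if h \<in> - G then pmf p h else 0)"
        using \<open>c \<ge> 0\<close> by (auto simp: d_def)
      finally show ?thesis .
    qed simp
  qed
  then show ?thesis by (simp add: measure_pmf_scales[OF supp])
qed

section \<open>Bad scales have vanishing mass\<close>

lemma E_pos_Markov:
  assumes "K > 0" "\<delta> > 0"
  shows "ennreal (measure (measure_pmf p) {h. \<delta> * K < f h}) \<le> ennreal (1 / \<delta>) * (E_pos p f / ennreal K)"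
proof -
  have "ennreal (measure (measure_pmf p) {h. \<delta> * K < f h})
      = (\<integral>\<^sup>+ h. indicator {h. \<delta> * K < f h} h \<partial>measure_pmf p)"
    by (simp add: measure_pmf.emeasure_eq_measure)
  also have "\<dots> \<le> (\<integral>\<^sup>+ h. ennreal (1 / (\<delta> * K)) * ennreal (max (f h) 0) \<partial>measure_pmf p)"
  proof (intro nn_integral_mono)
    fix h
    have "1 \<le> 1 / (\<delta> * K) * max (f h) 0" if "\<delta> * K < f h"
      using that assms by (simp add: field_simps max_def)
    moreover have "ennreal (1 / (\<delta> * K) * max (f h) 0) = ennreal (1 / (\<delta> * K)) * ennreal (max (f h) 0)"
      using assms by (intro ennreal_mult) auto
    ultimately show "indicator {h. \<delta> * K < f h} h \<le> ennreal (1 / (\<delta> * K)) * ennreal (max (f h) 0)"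
      using ennreal_leI[of 1 "1 / (\<delta> * K) * max (f h) 0"] by (cases "\<delta> * K < f h") auto
  qed
  also have "\<dots> = ennreal (1 / (\<delta> * K)) * E_pos p f"
    unfolding E_pos_def by (rule nn_integral_cmult) simp
  also have "ennreal (1 / (\<delta> * K)) = ennreal (1 / \<delta>) * ennreal (1 / K)"
    using assms by (simp add: ennreal_mult[symmetric])
  also have "ennreal (1 / K) = 1 / ennreal K"
    using assms by (simp add: divide_ennreal[symmetric])
  finally show ?thesis by (simp add: ennreal_times_divide mult.assoc mult.commute[of _ "E_pos p f"])
qed

lemma tendsto_prob_E_pos:
  assumes K: "\<forall>\<^sub>F m in sequentially. K m > 0" and "\<delta> > 0"
    and lim: "(\<lambda>m. E_pos (p m) (f m) / ennreal (K m)) \<longlonglongrightarrow> 0"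
  shows "(\<lambda>m. measure (measure_pmf (p m)) {h. \<delta> * K m < f m h}) \<longlonglongrightarrow> 0"
proof -
  have "(\<lambda>m. ennreal (measure (measure_pmf (p m)) {h. \<delta> * K m < f m h})) \<longlonglongrightarrow> 0"
  proof (rule tendsto_sandwich[OF _ _ tendsto_const])
    have "(\<lambda>m. ennreal (1 / \<delta>) * (E_pos (p m) (f m) / ennreal (K m))) \<longlonglongrightarrow> ennreal (1 / \<delta>) * 0"
      by (intro ennreal_tendsto_cmult lim) simp
    then show "(\<lambda>m. ennreal (1 / \<delta>) * (E_pos (p m) (f m) / ennreal (K m))) \<longlonglongrightarrow> 0"
      by simp
    show "\<forall>\<^sub>F m in sequentially. ennreal (measure (measure_pmf (p m)) {h. \<delta> * K m < f m h})
        \<le> ennreal (1 / \<delta>) * (E_pos (p m) (f m) / ennreal (K m))"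
      using K by eventually_elim (rule E_pos_Markov[OF _ \<open>\<delta> > 0\<close>])
  qed auto
  then show ?thesis
    using tendsto_ennreal_iff[of "\<lambda>m. measure (measure_pmf (p m)) {h. \<delta> * K m < f m h}" sequentially 0]
    by simp
qed

lemma infsum_Markov:
  assumes supp: "set_pmf p \<subseteq> scales"
    and sum: "(\<lambda>h. pmf p h * g h) summable_on scales"
    and g: "\<And>h. h \<in> scales \<Longrightarrow> 0 \<le> g h"
  shows "c * measure (measure_pmf p) {h. c < g h} \<le> (\<Sum>\<^sub>\<infinity>h\<in>scales. pmf p h * g h)"
proof -
  have "((\<lambda>h. c * pmf p h) has_sum c * measure (measure_pmf p) ({h. c < g h} \<inter> scales))
      ({h. c < g h} \<inter> scales)"
    by (intro has_sum_cmult_right pmf_has_sum_measure)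
  then have "c * measure (measure_pmf p) ({h. c < g h} \<inter> scales) \<le> (\<Sum>\<^sub>\<infinity>h\<in>scales. pmf p h * g h)"
    by (rule has_sum_mono_neutral[OF _ has_sum_infsum[OF sum]])
       (auto simp: g mult.commute[of c] intro!: mult_left_mono)
  then show ?thesis by (simp add: measure_pmf_Int_scales[OF supp])
qed

lemma deviation_summable:
  assumes "finite_entropy p"
  shows "(\<lambda>h. pmf p h * \<bar>H - ln (1 / pmf p h)\<bar>) summable_on scales"
proof (rule summable_on_comparison_test)
  show "(\<lambda>h. pmf p h * \<bar>H\<bar> + pmf p h * ln (1 / pmf p h)) summable_on scales"
    using assms unfolding finite_entropy_def
    by (intro summable_on_add summable_on_cmult_left has_sum_imp_summable[OF pmf_has_sum_measure])
  fix h
  have "0 \<le> ln (1 / pmf p h)"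
    by (cases "pmf p h = 0") (auto simp: pmf_le_1 pmf_pos)
  then have "\<bar>H - ln (1 / pmf p h)\<bar> \<le> \<bar>H\<bar> + ln (1 / pmf p h)" by linarith
  then show "pmf p h * \<bar>H - ln (1 / pmf p h)\<bar> \<le> pmf p h * \<bar>H\<bar> + pmf p h * ln (1 / pmf p h)"
    by (simp add: distrib_left[symmetric] mult_left_mono)
qed auto

text \<open>Every weight is at most the supremum \<open>s\<close>, so the entropy is an average of numbers that are at
  least \<open>- ln s\<close>. The positivity of \<open>s\<close> allows passing to the limit \<open>s \<rightarrow> 0\<close> in the logarithm.\<close>

lemma entropy_ge:
  assumes supp: "set_pmf p \<subseteq> scales" and "finite_entropy p"
  shows "- ln (SUP h\<in>scales. pmf p h) \<le> entropy p" and "0 < (SUP h\<in>scales. pmf p h)"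
proof -
  let ?s = "SUP h\<in>scales. pmf p h"
  have le: "pmf p h \<le> ?s" if "h \<in> scales" for h
    using that by (intro cSUP_upper bdd_aboveI2[where M = 1] pmf_le_1)
  obtain h0 where "h0 \<in> set_pmf p" using set_pmf_not_empty[of p] by blast
  then show s: "0 < ?s" using le[of h0] supp pmf_positive[of h0 p] by fastforce
  have "((\<lambda>h. - ln ?s * pmf p h) has_sum - ln ?s * measure (measure_pmf p) scales) scales"
    by (intro has_sum_cmult_right pmf_has_sum_measure)
  then have "- ln ?s * measure (measure_pmf p) scales \<le> entropy p"
    unfolding entropy_def
  proof (rule has_sum_mono[OF _ has_sum_infsum])
    show "(\<lambda>h. pmf p h * ln (1 / pmf p h)) summable_on scales"
      using assms by (simp add: finite_entropy_def)
    fix h assume h: "h \<in> scales"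
    show "- ln ?s * pmf p h \<le> pmf p h * ln (1 / pmf p h)"
    proof (cases "pmf p h = 0")
      case False
      then have "pmf p h > 0" by (simp add: order_less_le)
      then have "- ln ?s \<le> ln (1 / pmf p h)" using le[OF h] by (simp add: ln_div)
      then have "pmf p h * - ln ?s \<le> pmf p h * ln (1 / pmf p h)" by (rule mult_left_mono) simp
      then show ?thesis by (simp add: mult.commute)
    qed simp
  qed
  then show "- ln ?s \<le> entropy p" by (simp add: measure_pmf_scales[OF supp])
qed

lemma entropy_tendsto_infinity:
  assumes supp: "\<And>m. set_pmf (p m) \<subseteq> scales" and "\<And>m. finite_entropy (p m)"
    and lim: "(\<lambda>m. SUP h\<in>scales. pmf (p m) h) \<longlonglongrightarrow> 0"
  shows "filterlim (\<lambda>m. entropy (p m)) at_top sequentially"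
proof -
  have "filterlim (\<lambda>m. SUP h\<in>scales. pmf (p m) h) (at_right 0) sequentially"
    using lim entropy_ge(2)[OF assms(1,2)] by (simp add: tendsto_imp_filterlim_at_right)
  then have "filterlim (\<lambda>m. - ln (SUP h\<in>scales. pmf (p m) h)) at_top sequentially"
    unfolding filterlim_uminus_at_top minus_minus by (rule filterlim_compose[OF ln_at_0])
  then show ?thesis
    by (rule filterlim_at_top_mono) (simp add: entropy_ge(1)[OF assms(1,2)])
qed

lemma tendsto_prob_deviation:
  assumes supp: "\<And>m. set_pmf (p m) \<subseteq> scales" and fin: "\<And>m. finite_entropy (p m)"
    and K: "\<forall>\<^sub>F m in sequentially. ln (entropy (p m)) > 0" and "\<delta> > 0"
    and lim: "(\<lambda>m. 1 / ln (entropy (p m)) *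
       (\<Sum>\<^sub>\<infinity>h\<in>scales. pmf (p m) h * \<bar>entropy (p m) - ln (1 / pmf (p m) h)\<bar>)) \<longlonglongrightarrow> 0"
  shows "(\<lambda>m. measure (measure_pmf (p m))
      {h. \<delta> * ln (entropy (p m)) < \<bar>entropy (p m) - ln (1 / pmf (p m) h)\<bar>}) \<longlonglongrightarrow> 0"
    (is "?P \<longlonglongrightarrow> 0")
proof (rule tendsto_sandwich[OF _ _ tendsto_const])
  let ?D = "\<lambda>m. \<Sum>\<^sub>\<infinity>h\<in>scales. pmf (p m) h * \<bar>entropy (p m) - ln (1 / pmf (p m) h)\<bar>"
  show "(\<lambda>m. 1 / \<delta> * (1 / ln (entropy (p m)) * ?D m)) \<longlonglongrightarrow> 0"
    using tendsto_mult_left[OF lim, of "1 / \<delta>"] by simp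
  show "\<forall>\<^sub>F m in sequentially. ?P m \<le> 1 / \<delta> * (1 / ln (entropy (p m)) * ?D m)"
    using K
  proof eventually_elim
    case (elim m)
    have "\<delta> * ln (entropy (p m)) * ?P m \<le> ?D m"
      by (rule infsum_Markov[OF supp deviation_summable[OF fin]]) simp
    then show ?case using elim \<open>\<delta> > 0\<close> by (simp add: field_simps)
  qed
qed auto

section \<open>Type II errors of the MAP multi-level test\<close>

theorem theorem3:
  fixes \<sigma> \<alpha> :: real and p :: "nat \<Rightarrow> real pmf" and A :: "nat \<Rightarrow> real \<Rightarrow> real"
  assumes sigma_pos: "\<sigma> > 0"
    and alpha: "0 < \<alpha>" "\<alpha> < 1"
    and supp: "\<And>m. set_pmf (p m) \<subseteq> scales"
    and fin_ent: "\<And>m. finite_entropy (p m)"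
    and vanishing: "(\<lambda>m. SUP h\<in>scales. pmf (p m) h) \<longlonglongrightarrow> 0"
    and ent_cond: "(\<lambda>m. 1 / ln (entropy (p m)) *
       (\<Sum>\<^sub>\<infinity>h\<in>scales. pmf (p m) h * \<bar>entropy (p m) - ln (1 / pmf (p m) h)\<bar>)) \<longlonglongrightarrow> 0"
    and A_pos: "\<And>m h. h \<in> scales \<Longrightarrow> A m h > 0"
  shows "(\<forall>x \<epsilon>. \<epsilon> > 0 \<longrightarrow>
           (\<lambda>m. E_pos (p m) (\<lambda>h. (A m h / sigma_scale \<sigma> h - x)\<^sup>2 + \<epsilon> * entropy_star (p m)
                    - R h (q_level \<alpha>) (entropy (p m)))
                / ennreal (entropy_star (p m))) \<longlonglongrightarrow> 0 \<longrightarrow>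
           liminf (\<lambda>m. ereal (avg_beta_M \<sigma> \<alpha> (p m) (A m))) \<ge> ereal ((1 - \<alpha>) * (1 - Phi x)))
       \<and> (\<forall>\<epsilon>. \<epsilon> > 0 \<longrightarrow>
           (\<lambda>m. E_pos (p m) (\<lambda>h. R h (q_level \<alpha>) (entropy (p m))
                    + 2 * sqrt (\<epsilon> * entropy_star (p m)) * (A m h / sigma_scale \<sigma> h)
                    - (A m h)\<^sup>2 / (sigma_scale \<sigma> h)\<^sup>2)
                / ennreal (entropy_star (p m))) \<longlonglongrightarrow> 0 \<longrightarrow>
           (\<lambda>m. avg_beta_M \<sigma> \<alpha> (p m) (A m)) \<longlonglongrightarrow> 0)"
proof -
  define H where "H m = entropy (p m)" for m
  have H: "filterlim H at_top sequentially"
    unfolding H_def using supp fin_ent vanishing by (rule entropy_tendsto_infinity)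
  have eventually_H: "\<forall>\<^sub>F m in sequentially. P (H m)" if "\<forall>\<^sub>F x in at_top. P x" for P :: "real \<Rightarrow> bool"
    using eventually_compose_filterlim[OF that H] .
  have K: "\<forall>\<^sub>F m in sequentially. ln (H m) > 0"
    by (rule eventually_H) real_asymp
  define dev where "dev m h = \<bar>H m - ln (1 / pmf (p m) h)\<bar>" for m h
  have bad: "(\<lambda>m. measure (measure_pmf (p m))
        (- {h. dev m h \<le> \<epsilon> / 8 * ln (H m) \<and> f m h \<le> \<epsilon> / 2 * ln (H m)})) \<longlonglongrightarrow> 0"
    if "\<epsilon> > 0" and f: "(\<lambda>m. E_pos (p m) (f m) / ennreal (ln (H m))) \<longlonglongrightarrow> 0" for \<epsilon> f
  proof (rule tendsto_sandwich[OF _ _ tendsto_const])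
    have "(\<lambda>m. measure (measure_pmf (p m)) {h. \<epsilon> / 8 * ln (H m) < dev m h}) \<longlonglongrightarrow> 0"
      unfolding dev_def H_def
      using supp fin_ent K[unfolded H_def] _ ent_cond
      by (rule tendsto_prob_deviation) (use \<open>\<epsilon> > 0\<close> in simp)
    moreover have "(\<lambda>m. measure (measure_pmf (p m)) {h. \<epsilon> / 2 * ln (H m) < f m h}) \<longlonglongrightarrow> 0"
      by (rule tendsto_prob_E_pos[OF K _ f]) (use \<open>\<epsilon> > 0\<close> in simp)
    ultimately show "(\<lambda>m. measure (measure_pmf (p m)) {h. \<epsilon> / 8 * ln (H m) < dev m h}
        + measure (measure_pmf (p m)) {h. \<epsilon> / 2 * ln (H m) < f m h}) \<longlonglongrightarrow> 0"
      by (rule tendsto_add_zero)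
    have "- {h. dev m h \<le> \<epsilon> / 8 * ln (H m) \<and> f m h \<le> \<epsilon> / 2 * ln (H m)}
        = {h. \<epsilon> / 8 * ln (H m) < dev m h} \<union> {h. \<epsilon> / 2 * ln (H m) < f m h}" for m
      by auto
    then show "\<forall>\<^sub>F m in sequentially. measure (measure_pmf (p m))
          (- {h. dev m h \<le> \<epsilon> / 8 * ln (H m) \<and> f m h \<le> \<epsilon> / 2 * ln (H m)})
        \<le> measure (measure_pmf (p m)) {h. \<epsilon> / 8 * ln (H m) < dev m h}
          + measure (measure_pmf (p m)) {h. \<epsilon> / 2 * ln (H m) < f m h}"
      by (simp add: measure_Un_le)
  qed auto
  have lower_bound: "ereal ((1 - \<alpha>) * (1 - Phi x)) \<le> liminf (\<lambda>m. ereal (avg_beta_M \<sigma> \<alpha> (p m) (A m)))"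
    if "\<epsilon> > 0" and f: "(\<lambda>m. E_pos (p m) (\<lambda>h. (A m h / sigma_scale \<sigma> h - x)\<^sup>2 + \<epsilon> * ln (H m)
        - R h (q_level \<alpha>) (H m)) / ennreal (ln (H m))) \<longlonglongrightarrow> 0" for x \<epsilon>
  proof -
    let ?c = "(1 - \<alpha>) * (1 - Phi x)"
    define G where "G m = {h. dev m h \<le> \<epsilon> / 8 * ln (H m) \<and>
      (A m h / sigma_scale \<sigma> h - x)\<^sup>2 + \<epsilon> * ln (H m) - R h (q_level \<alpha>) (H m) \<le> \<epsilon> / 2 * ln (H m)}" for m
    have G: "(\<lambda>m. measure (measure_pmf (p m)) (- G m)) \<longlonglongrightarrow> 0"
      unfolding G_def by (rule bad[OF \<open>\<epsilon> > 0\<close> f])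
    have "(\<lambda>m. ?c * (1 - measure (measure_pmf (p m)) (- G m))) \<longlonglongrightarrow> ?c * (1 - 0)"
      by (intro tendsto_intros G)
    then have "(\<lambda>m. ereal (?c * (1 - measure (measure_pmf (p m)) (- G m)))) \<longlonglongrightarrow> ereal ?c"
      by simp
    then have "ereal ?c = liminf (\<lambda>m. ereal (?c * (1 - measure (measure_pmf (p m)) (- G m))))"
      by (intro lim_imp_Liminf[symmetric]) auto
    also have "\<dots> \<le> liminf (\<lambda>m. ereal (avg_beta_M \<sigma> \<alpha> (p m) (A m)))"
    proof (rule Liminf_mono)
      show "\<forall>\<^sub>F m in sequentially. ereal (?c * (1 - measure (measure_pmf (p m)) (- G m)))
          \<le> ereal (avg_beta_M \<sigma> \<alpha> (p m) (A m))"
        using eventually_H[OF cutoff_le_Phi_of_small_amplitude[OF \<open>\<epsilon> > 0\<close>, where q = "q_level \<alpha>" and x = x]]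
      proof eventually_elim
        case (elim m)
        have "?c * measure (measure_pmf (p m)) (G m) \<le> avg_beta_M \<sigma> \<alpha> (p m) (A m)"
        proof (rule avg_beta_M_lower[OF supp])
          show "0 \<le> ?c" using alpha Phi_le_1 by simp
          fix h t assume h: "h \<in> scales" "h \<in> G m" "pmf (p m) h > 0" and t: "t \<in> grid h"
          have small: "\<bar>H m - ln (1 / pmf (p m) h)\<bar> \<le> \<epsilon> / 8 * ln (H m)"
            "(A m h / sigma_scale \<sigma> h - x)\<^sup>2 + \<epsilon> * ln (H m) - R h (q_level \<alpha>) (H m) \<le> \<epsilon> / 2 * ln (H m)"
            using h(2) unfolding G_def dev_def by blast+
          have "cutoff (q_level \<alpha>) (n_scale h) (pmf (p m) h) \<le> Phi (x - A m h / sigma_scale \<sigma> h)"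
            by (rule elim[rule_format, OF h(1,3) small])
          then show "?c \<le> beta_M \<sigma> \<alpha> (p m) h t (A m h)"
            using h t by (intro beta_M_lower sigma_pos alpha) (auto simp: indices_def)
        qed
        then show ?case using measure_pmf.prob_compl[of "G m" "p m"] by (simp add: Compl_eq_Diff_UNIV)
      qed
    qed
    finally show ?thesis .
  qed
  have upper_bound: "(\<lambda>m. avg_beta_M \<sigma> \<alpha> (p m) (A m)) \<longlonglongrightarrow> 0"
    if "\<epsilon> > 0" and f: "(\<lambda>m. E_pos (p m) (\<lambda>h. R h (q_level \<alpha>) (H m)
        + 2 * sqrt (\<epsilon> * ln (H m)) * (A m h / sigma_scale \<sigma> h)
        - (A m h)\<^sup>2 / (sigma_scale \<sigma> h)\<^sup>2) / ennreal (ln (H m))) \<longlonglongrightarrow> 0" for \<epsilon>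
  proof (rule order_tendstoI)
    fix e :: real assume "e < 0"
    then have "e < avg_beta_M \<sigma> \<alpha> (p m) (A m)" for m
      using avg_beta_M_nonneg[OF supp] by (rule less_le_trans)
    then show "\<forall>\<^sub>F m in sequentially. e < avg_beta_M \<sigma> \<alpha> (p m) (A m)"
      by simp
  next
    fix e :: real assume "e > 0"
    have "\<forall>\<^sub>F M in at_top. 1 - e / 2 < Phi M"
      using std_normal.cdf_lim_at_top_prob \<open>e > 0\<close> unfolding Phi_def by (intro order_tendstoD) auto
    then obtain M where "1 - e / 2 < Phi M"
      by (auto simp: eventually_at_top_linorder)
    then have M: "1 - Phi M < e / 2" by linarith
    define G where "G m = {h. dev m h \<le> \<epsilon> / 8 * ln (H m) \<and>
      R h (q_level \<alpha>) (H m) + 2 * sqrt (\<epsilon> * ln (H m)) * (A m h / sigma_scale \<sigma> h)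
        - (A m h)\<^sup>2 / (sigma_scale \<sigma> h)\<^sup>2 \<le> \<epsilon> / 2 * ln (H m)}" for m
    have "(\<lambda>m. measure (measure_pmf (p m)) (- G m)) \<longlonglongrightarrow> 0"
      unfolding G_def by (rule bad[OF \<open>\<epsilon> > 0\<close> f])
    then have "\<forall>\<^sub>F m in sequentially. measure (measure_pmf (p m)) (- G m) < e / 2"
      using \<open>e > 0\<close> by (intro order_tendstoD) auto
    then show "\<forall>\<^sub>F m in sequentially. avg_beta_M \<sigma> \<alpha> (p m) (A m) < e"
      using eventually_H[OF Phi_less_cutoff_of_large_amplitude[OF \<open>\<epsilon> > 0\<close>, where q = "q_level \<alpha>" and M = M]]
    proof eventually_elim
      case (elim m)
      have "avg_beta_M \<sigma> \<alpha> (p m) (A m) \<le> (1 - Phi M) + measure (measure_pmf (p m)) (- G m)"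
      proof (rule avg_beta_M_upper[OF supp])
        show "0 \<le> 1 - Phi M" using Phi_le_1 by simp
        fix h t assume h: "h \<in> scales" "h \<in> G m" "pmf (p m) h > 0" and t: "t \<in> grid h"
        have a_pos: "A m h / sigma_scale \<sigma> h > 0"
          by (rule divide_pos_pos[OF A_pos[OF h(1)] sigma_scale_pos[OF sigma_pos h(1)]])
        have large: "\<bar>H m - ln (1 / pmf (p m) h)\<bar> \<le> \<epsilon> / 8 * ln (H m)"
          "R h (q_level \<alpha>) (H m) + 2 * sqrt (\<epsilon> * ln (H m)) * (A m h / sigma_scale \<sigma> h)
            - (A m h / sigma_scale \<sigma> h)\<^sup>2 \<le> \<epsilon> / 2 * ln (H m)"
          using h(2) unfolding G_def dev_def power_divide by blast+
        have "Phi (M - A m h / sigma_scale \<sigma> h) < cutoff (q_level \<alpha>) (n_scale h) (pmf (p m) h)"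
          by (rule elim(2)[rule_format, OF h(1,3) a_pos large])
        then show "beta_M \<sigma> \<alpha> (p m) h t (A m h) \<le> 1 - Phi M"
          using h t by (intro beta_M_upper sigma_pos) (auto simp: indices_def)
      qed
      then show ?case using elim(1) M by linarith
    qed
  qed
  show ?thesis
    unfolding entropy_star_def
    by (intro conjI allI impI) (erule (1) lower_bound[unfolded H_def], erule (1) upper_bound[unfolded H_def])
qed

end
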